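(* Let $(\bm B^{n},\bm v^{n})$ and $(\bm B^{n+1},\bm v^{n+1})$ be related by the two-dimensional finite difference constrained transport (CT) scheme given in the context. Assume $(\nabla\cdot\bm B)_{ij}^{n}=0$ for all $i$ and $j$. Then $(\nabla\cdot\bm B)_{ij}^{n+1}=0$ for all $i$ and $j$.
   Context: Uniform 2D grid with spacings $\Delta x,\Delta y>0$, grid points $(x_i,y_j)$, time step $\Delta t>0$; the relations below hold at all grid indices $(i,j)$ (infinite grid or periodic indexing). $\bm B_{ij}=(B^x_{ij},B^y_{ij},B^z_{ij})^\top$, $\bm v_{ij}=(v^x_{ij},v^y_{ij},v^z_{ij})^\top\in\mathbb R^3$; $\rho_{ij}^n>0$ is given. Set $\bm B_{ij}^{n+\frac12}=\frac12(\bm B_{ij}^n+\bm B_{ij}^{n+1})$, $\bm v_{ij}^{n+\frac12}=\frac12(\bm v_{ij}^n+\bm v_{ij}^{n+1})$, $\mathbf\Omega_{ij}^{n+\frac12}=\bm B_{ij}^{n+\frac12}\times\bm v_{ij}^{n+\frac12}=(\Omega^x,\Omega^y,\Omega^z)_{ij}^{n+\frac12}$. For a grid function $f$ write $D_xf_{ij}=\frac{f_{i+1,j}-f_{i-1,j}}{2\Delta x}$, $D_yf_{ij}=\frac{f_{i,j+1}-f_{i,j-1}}{2\Delta y}$. The (implicit) CT scheme is $$B^{x,n+1}_{ij}=B^{x,n}_{ij}-\Delta t\,D_y\Omega^{z,n+\frac12}_{ij},\quad B^{y,n+1}_{ij}=B^{y,n}_{ij}+\Delta t\,D_x\Omega^{z,n+\frac12}_{ij},$$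 $$B^{z,n+1}_{ij}=B^{z,n}_{ij}-\Delta t\,D_x\Omega^{y,n+\frac12}_{ij}+\Delta t\,D_y\Omega^{x,n+\frac12}_{ij},$$ $$\rho_{ij}^n\bm v_{ij}^{n+1}=\rho_{ij}^n\bm v_{ij}^n-\Delta t\,\bm B_{ij}^{n+\frac12}\times\operatorname{curl}\bm B_{ij}^{n+\frac12},\qquad \operatorname{curl}\bm B_{ij}:=\left(D_yB^z_{ij},\ -D_xB^z_{ij},\ D_xB^y_{ij}-D_yB^x_{ij}\right)^\top .$$ The discrete divergence is $(\nabla\cdot\bm B)_{ij}^n:=\frac{B^{x,n}_{i+1,j}-B^{x,n}_{i-1,j}}{2\Delta x}+\frac{B^{y,n}_{i,j+1}-B^{y,n}_{i,j-1}}{2\Delta y}$. *)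

theory Defs
  imports "HOL-Analysis.Analysis"
begin

(* Grid functions live on the infinite index grid \<int> x \<int>. Periodic indexing is the
   special case of grid functions that are periodic in both indices. *)
type_synonym 'a grid = "int \<Rightarrow> int \<Rightarrow> 'a"

definition Dx :: "real \<Rightarrow> real grid \<Rightarrow> real grid" where
  "Dx \<Delta>x f i j = (f (i + 1) j - f (i - 1) j) / (2 * \<Delta>x)"

definition Dy :: "real \<Rightarrow> real grid \<Rightarrow> real grid" where
  "Dy \<Delta>y f i j = (f i (j + 1) - f i (j - 1)) / (2 * \<Delta>y)"

(* The components x, y, z of a vector-valued grid function have the indices 1, 2, 3. *)
definition grid_comp :: "(real ^ 3) grid \<Rightarrow> 3 \<Rightarrow> real grid" where
  "grid_comp u k i j = u i j $ k"

definition curl_grid :: "real \<Rightarrow> real \<Rightarrow> (real ^ 3) grid \<Rightarrow> (real ^ 3) grid" where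
  "curl_grid \<Delta>x \<Delta>y B i j =
     vector [Dy \<Delta>y (grid_comp B 3) i j,
             - Dx \<Delta>x (grid_comp B 3) i j,
             Dx \<Delta>x (grid_comp B 2) i j - Dy \<Delta>y (grid_comp B 1) i j]"

definition div_grid :: "real \<Rightarrow> real \<Rightarrow> (real ^ 3) grid \<Rightarrow> real grid" where
  "div_grid \<Delta>x \<Delta>y B i j =
     (B (i + 1) j $ 1 - B (i - 1) j $ 1) / (2 * \<Delta>x)
     + (B i (j + 1) $ 2 - B i (j - 1) $ 2) / (2 * \<Delta>y)"

definition half_step :: "(real ^ 3) grid \<Rightarrow> (real ^ 3) grid \<Rightarrow> (real ^ 3) grid" where
  "half_step u u' i j = (1 / 2) *\<^sub>R (u i j + u' i j)"

definition Omega_half ::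
  "(real ^ 3) grid \<Rightarrow> (real ^ 3) grid \<Rightarrow> (real ^ 3) grid \<Rightarrow> (real ^ 3) grid \<Rightarrow> (real ^ 3) grid" where
  "Omega_half B v B' v' i j = cross3 (half_step B B' i j) (half_step v v' i j)"

(* One step of the implicit CT scheme: B, v are the fields at time level n, and B', v' those at
   level n+1; \<rho> is the density at level n. *)
definition CT_step ::
  "real \<Rightarrow> real \<Rightarrow> real \<Rightarrow> real grid \<Rightarrow> (real ^ 3) grid \<Rightarrow> (real ^ 3) grid
     \<Rightarrow> (real ^ 3) grid \<Rightarrow> (real ^ 3) grid \<Rightarrow> bool" where
  "CT_step \<Delta>x \<Delta>y \<Delta>t \<rho> B v B' v' \<longleftrightarrow>
     (let \<Omega> = Omega_half B v B' v'; Bh = half_step B B' in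
      \<forall>i j.
        B' i j $ 1 = B i j $ 1 - \<Delta>t * Dy \<Delta>y (grid_comp \<Omega> 3) i j \<and>
        B' i j $ 2 = B i j $ 2 + \<Delta>t * Dx \<Delta>x (grid_comp \<Omega> 3) i j \<and>
        B' i j $ 3 = B i j $ 3 - \<Delta>t * Dx \<Delta>x (grid_comp \<Omega> 2) i j
                               + \<Delta>t * Dy \<Delta>y (grid_comp \<Omega> 1) i j \<and>
        \<rho> i j *\<^sub>R v' i j = \<rho> i j *\<^sub>R v i j
          - \<Delta>t *\<^sub>R cross3 (Bh i j) (curl_grid \<Delta>x \<Delta>y Bh i j))"

end

theory Submission
  imports Defs
begin

text \<open>
  The updates of the first two components of the magnetic field form the discrete curl of the
  third component of Omega, and the central difference operators in x and y commute, so the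
  discrete divergence is the same at both time levels, whatever Omega is.
\<close>

text \<open>Both sides are the same signed sum of \<open>f\<close> over the four diagonal neighbours
  of (i, j), divided by \<open>2 * \<Delta>x\<close> and \<open>2 * \<Delta>y\<close>.\<close>

lemma Dx_Dy_commute: "Dx \<Delta>x (Dy \<Delta>y f) i j = Dy \<Delta>y (Dx \<Delta>x f) i j"
  by (simp add: Dx_def Dy_def diff_divide_distrib mult.commute)

lemma div_grid_eq: "div_grid \<Delta>x \<Delta>y B i j = Dx \<Delta>x (grid_comp B 1) i j + Dy \<Delta>y (grid_comp B 2) i j"
  by (simp add: div_grid_def Dx_def Dy_def grid_comp_def)

lemma Dx_diff_scaled: "Dx \<Delta>x (\<lambda>i j. f i j - c * g i j) i j = Dx \<Delta>x f i j - c * Dx \<Delta>x g i j"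
  by (simp add: Dx_def diff_divide_distrib right_diff_distrib)

lemma Dy_add_scaled: "Dy \<Delta>y (\<lambda>i j. f i j + c * g i j) i j = Dy \<Delta>y f i j + c * Dy \<Delta>y g i j"
  by (simp add: Dy_def diff_divide_distrib add_divide_distrib right_diff_distrib)

lemma div_grid_CT_step:
  assumes "CT_step \<Delta>x \<Delta>y \<Delta>t \<rho> B v B' v'"
  shows "div_grid \<Delta>x \<Delta>y B' i j = div_grid \<Delta>x \<Delta>y B i j"
proof -
  define w where "w = grid_comp (Omega_half B v B' v') 3"
  \<comment> \<open>Equalities of whole grid functions, because \<open>Dx\<close> and
    \<open>Dy\<close> read values at neighbouring points.\<close>
  have "grid_comp B' 1 = (\<lambda>i j. grid_comp B 1 i j - \<Delta>t * Dy \<Delta>y w i j)"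
    and "grid_comp B' 2 = (\<lambda>i j. grid_comp B 2 i j + \<Delta>t * Dx \<Delta>x w i j)"
    using assms by (auto simp: CT_step_def Let_def w_def grid_comp_def[of B] grid_comp_def[of B'] fun_eq_iff)
  then show ?thesis
    \<comment> \<open>By linearity the divergence changes by \<open>- \<Delta>t * Dx \<Delta>x (Dy
      \<Delta>y w) i j + \<Delta>t * Dy \<Delta>y (Dx \<Delta>x w) i j\<close>, which
      cancels.\<close>
    by (simp add: div_grid_eq Dx_diff_scaled Dy_add_scaled Dx_Dy_commute)
qed

theorem theorem3p11:
  fixes \<Delta>x \<Delta>y \<Delta>t :: real
    and \<rho> :: "real grid"
    and B v B' v' :: "(real ^ 3) grid"
  assumes "\<Delta>x > 0" and "\<Delta>y > 0" and "\<Delta>t > 0"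
    and "\<And>i j. \<rho> i j > 0"
    and "CT_step \<Delta>x \<Delta>y \<Delta>t \<rho> B v B' v'"
    and "\<forall>i j. div_grid \<Delta>x \<Delta>y B i j = 0"
  shows "\<forall>i j. div_grid \<Delta>x \<Delta>y B' i j = 0"
  using assms(5,6) by (simp add: div_grid_CT_step)

end
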